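(* The generalized left Fischer cover is canonical. That is: let $X_1,X_2$ be sofic shifts with generalized left Fischer covers $(G_1,\mathcal{L}_1)$ and $(G_2,\mathcal{L}_2)$, and let $\pi_i\colon \mathsf{X}_{G_i}\to X_i$ ($i=1,2$) be the corresponding covering maps. For every conjugacy $\Phi\colon X_1\to X_2$ there exists a conjugacy $\varphi\colon\mathsf{X}_{G_1}\to\mathsf{X}_{G_2}$ such that $\Phi\circ\pi_1=\pi_2\circ\varphi$.
   Context: A shift space is a closed subset $X\subseteq\mathcal{A}^{\mathbb{Z}}$ ($\mathcal{A}$ a finite discrete alphabet, product topology) invariant under the shift $\sigma(x)_i=x_{i+1}$. It is sofic if it is the image of a shift of finite type under a continuous shift-commuting map. A conjugacy is a bijective, continuous, shift-commuting map between shift spaces. $X^+=\{x_0x_1x_2\cdots : x\in X\}$ and $X^-=\{\cdots x_{-2}x_{-1} : x\in X\}$. For $x^+\in X^+$, $P_\infty(x^+)=\{y^-\in X^- : y^-x^+\in X\}$. For a finite essential directed graph $E=(E^0,E^1,r,s)$ (every vertex emits and receives an edge; edge $e$ goes from $s(e)$ to $r(e)$), the edge shift is $\mathsf{X}_E=\{x\in(E^1)^{\mathbb{Z}} : r(x_i)=s(x_{i+1})\ \forall i\in\mathbb{Z}\}$. For a labelling $\mathcal{L}\colon E^1\to\mathcal{A}$, $(E,\mathcal{L})$ presents the sofic shift $\{(\mathcal{L}(x_i))_i : x\in\mathsf{X}_E\}$, and the covering map is the map $\pi\colon x\mapsto(\mathcal{L}(x_i))_i$ from $\mathsf{X}_E$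 onto this sofic shift. The left Krieger cover $(K,\mathcal{L}_K)$ of a sofic shift $X$ is the labelled graph with vertex set $K^0=\{P_\infty(x^+) : x^+\in X^+\}$ (finite since $X$ is sofic) which has an edge labelled $a\in\mathcal{A}$ from $P$ to $P'$ if and only if there is $x^+\in X^+$ with $ax^+\in X^+$, $P=P_\infty(ax^+)$ and $P'=P_\infty(x^+)$. For vertices, $u\geq v$ means that there is a path (possibly of length $0$) from $u$ to $v$. A vertex $P\in K^0$ is non-decomposable if whenever $V\subseteq K^0$ and $P=\bigcup_{Q\in V}Q$, then $P\in V$. The generalized left Fischer cover $(G,\mathcal{L}_G)$ of $X$ is the labelled subgraph of $(K,\mathcal{L}_K)$ with vertex set $G^0=\{P\in K^0 : P\geq P' \text{ for some non-decomposable } P'\in K^0\}$ and all edges with both endpoints in $G^0$. It is a finite essential labelled graph presenting $X$. *)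

theory Defs
  imports "HOL-Analysis.Analysis" "Graph_Theory.Digraph_Component"
begin

section \<open>Shift spaces\<close>

definition full_shift :: "'a set \<Rightarrow> (int \<Rightarrow> 'a) topology" where
  "full_shift A = product_topology (\<lambda>_. discrete_topology A) UNIV"

definition shift :: "(int \<Rightarrow> 'a) \<Rightarrow> int \<Rightarrow> 'a" where
  "shift x = (\<lambda>i. x (i + 1))"

definition shift_space :: "'a set \<Rightarrow> (int \<Rightarrow> 'a) set \<Rightarrow> bool" where
  "shift_space A X \<longleftrightarrow> finite A \<and> closedin (full_shift A) X \<and> shift ` X = X"

definition shift_morphism ::
  "'a set \<Rightarrow> (int \<Rightarrow> 'a) set \<Rightarrow> 'b set \<Rightarrow> (int \<Rightarrow> 'b) set \<Rightarrow> ((int \<Rightarrow> 'a) \<Rightarrow> int \<Rightarrow> 'b) \<Rightarrow> bool" where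
  "shift_morphism A X B Y f \<longleftrightarrow>
     shift_space A X \<and> shift_space B Y \<and>
     continuous_map (subtopology (full_shift A) X) (subtopology (full_shift B) Y) f \<and>
     (\<forall>x\<in>X. f (shift x) = shift (f x))"

definition conjugacy ::
  "'a set \<Rightarrow> (int \<Rightarrow> 'a) set \<Rightarrow> 'b set \<Rightarrow> (int \<Rightarrow> 'b) set \<Rightarrow> ((int \<Rightarrow> 'a) \<Rightarrow> int \<Rightarrow> 'b) \<Rightarrow> bool" where
  "conjugacy A X B Y f \<longleftrightarrow> shift_morphism A X B Y f \<and> bij_betw f X Y"

definition occurs_in :: "'a list \<Rightarrow> (int \<Rightarrow> 'a) \<Rightarrow> bool" where
  "occurs_in w x \<longleftrightarrow> (\<exists>i. \<forall>k<length w. x (i + int k) = w ! k)"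

definition shift_of_finite_type :: "'a set \<Rightarrow> (int \<Rightarrow> 'a) set \<Rightarrow> bool" where
  "shift_of_finite_type A X \<longleftrightarrow>
     finite A \<and> (\<exists>F. finite F \<and> X = {x \<in> topspace (full_shift A). \<forall>w\<in>F. \<not> occurs_in w x})"

text \<open>HOL cannot quantify existentially over the type of the letters of the covering shift of
  finite type. Alphabets are finite, so it is enough to let them range over finite sets of
  natural numbers.\<close>

definition sofic :: "'a set \<Rightarrow> (int \<Rightarrow> 'a) set \<Rightarrow> bool" where
  "sofic A X \<longleftrightarrow> shift_space A X \<and>
     (\<exists>(B :: nat set) Y f. shift_of_finite_type B Y \<and> shift_morphism B Y A X f \<and> f ` Y = X)"

section \<open>Rays and predecessor sets\<close>

text \<open>Both kinds of rays are functions on the natural numbers. A left ray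
  \<open>\<cdots> y\<^sub>-\<^sub>2 y\<^sub>-\<^sub>1\<close> is indexed from right to left, starting with \<open>y\<^sub>-\<^sub>1\<close> at index \<open>0\<close>.\<close>

definition right_rays :: "(int \<Rightarrow> 'a) set \<Rightarrow> (nat \<Rightarrow> 'a) set" where
  "right_rays X = (\<lambda>x n. x (int n)) ` X"

definition left_rays :: "(int \<Rightarrow> 'a) set \<Rightarrow> (nat \<Rightarrow> 'a) set" where
  "left_rays X = (\<lambda>x n. x (- 1 - int n)) ` X"

definition join_rays :: "(nat \<Rightarrow> 'a) \<Rightarrow> (nat \<Rightarrow> 'a) \<Rightarrow> int \<Rightarrow> 'a" where
  "join_rays y x = (\<lambda>i. if i < 0 then y (nat (- 1 - i)) else x (nat i))"

definition cons_ray :: "'a \<Rightarrow> (nat \<Rightarrow> 'a) \<Rightarrow> nat \<Rightarrow> 'a" where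
  "cons_ray a x = case_nat a x"

definition P_inf :: "(int \<Rightarrow> 'a) set \<Rightarrow> (nat \<Rightarrow> 'a) \<Rightarrow> (nat \<Rightarrow> 'a) set" where
  "P_inf X x = {y \<in> left_rays X. join_rays y x \<in> X}"

section \<open>Edge shifts and covers\<close>

definition edge_shift :: "('v, 'e) pre_digraph \<Rightarrow> (int \<Rightarrow> 'e) set" where
  "edge_shift E = {x. (\<forall>i. x i \<in> arcs E) \<and> (\<forall>i. head E (x i) = tail E (x (i + 1)))}"

definition covering_map :: "('e \<Rightarrow> 'a) \<Rightarrow> (int \<Rightarrow> 'e) \<Rightarrow> int \<Rightarrow> 'a" where
  "covering_map L x = (\<lambda>i. L (x i))"

text \<open>A Krieger edge labelled \<open>a\<close> from \<open>P\<close> to \<open>P'\<close> is the triple \<open>(P, a, P')\<close>: for given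
  endpoints and label there is at most one edge.\<close>

type_synonym 'a krieger_vertex = "(nat \<Rightarrow> 'a) set"
type_synonym 'a krieger_edge = "'a krieger_vertex \<times> 'a \<times> 'a krieger_vertex"

definition krieger_label :: "'a krieger_edge \<Rightarrow> 'a" where
  "krieger_label = (\<lambda>(P, a, P'). a)"

definition left_krieger_cover ::
  "(int \<Rightarrow> 'a) set \<Rightarrow> ('a krieger_vertex, 'a krieger_edge) pre_digraph" where
  "left_krieger_cover X =
     \<lparr> verts = P_inf X ` right_rays X,
       arcs = {(P, a, P'). \<exists>x \<in> right_rays X. cons_ray a x \<in> right_rays X \<and>
                 P = P_inf X (cons_ray a x) \<and> P' = P_inf X x},
       tail = (\<lambda>(P, a, P'). P),
       head = (\<lambda>(P, a, P'). P') \<rparr>"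

definition non_decomposable :: "(int \<Rightarrow> 'a) set \<Rightarrow> 'a krieger_vertex \<Rightarrow> bool" where
  "non_decomposable X P \<longleftrightarrow>
     P \<in> verts (left_krieger_cover X) \<and>
     (\<forall>V. V \<subseteq> verts (left_krieger_cover X) \<and> P = \<Union>V \<longrightarrow> P \<in> V)"

definition generalized_left_fischer_cover ::
  "(int \<Rightarrow> 'a) set \<Rightarrow> ('a krieger_vertex, 'a krieger_edge) pre_digraph" where
  "generalized_left_fischer_cover X =
     induce_subgraph (left_krieger_cover X)
       {P \<in> verts (left_krieger_cover X).
          \<exists>P'. non_decomposable X P' \<and> reachable (left_krieger_cover X) P P'}"

end

theory Submission
  imports Defs
begin

text \<open>Every point \<open>x\<close> of a shift space \<open>X\<close> traces the bi-infinite path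
\<open>i \<mapsto> (P\<^sub>\<infinity>(x\<^sub>i x\<^sub>i\<^sub>+\<^sub>1 \<dots>), x\<^sub>i, P\<^sub>\<infinity>(x\<^sub>i\<^sub>+\<^sub>1 \<dots>))\<close> in the left Krieger cover,
called \<open>krieger_path X x\<close> below. These paths are dense in the edge shift of the cover, even in a
strong sense: every \<open>\<xi>\<close> in the edge shift coincides on any given left half-line with the path of some
point of \<open>X\<close> (\<open>path_approximation\<close>). A conjugacy \<open>\<Phi>\<close> is therefore lifted by extending
\<open>krieger_path X x \<mapsto> krieger_path Y (\<Phi> x)\<close> to the closure. For the extension to exist and to be a
block map, the predecessor set of \<open>\<Phi> x\<close> at a position must be determined by finitely many letters
of \<open>x\<close> and one predecessor set of \<open>x\<close>; this is \<open>pred_set_image\<close>. The pasts that can be put in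
front of the right half of \<open>\<Phi> x\<close> are found by moving to \<open>X\<close> with \<open>\<Phi>\<inverse>\<close>, exchanging the right half
there, and moving back; since \<open>\<Phi>\<close> and \<open>\<Phi>\<inverse>\<close> have bounded windows, only boundedly many letters
around the seam matter. Applied to \<open>\<Phi>\<inverse>\<close> the same construction gives the inverse of the lift, so the
left Krieger cover is canonical.

It remains to see that the lift respects the generalized left Fischer covers. A path \<open>\<xi>\<close> lies in
the Fischer cover if each of its vertices reaches a non-decomposable one. Hence \<open>\<xi>\<close> agrees up to any
position with the path of a point \<open>x\<close> whose predecessor set is non-decomposable somewhere further to
the right, at \<open>N\<close> say. The key lemma \<open>fischer_vertex_image\<close> shows that the predecessor sets of \<open>\<Phi> x\<close>
then reach a non-decomposable vertex too. Write the predecessor set of \<open>\<Phi> x\<close> at a position somewhat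
to the right of \<open>N\<close> as a union of non-decomposable ones. Pulling this decomposition back through
\<open>\<Phi>\<inverse>\<close> expresses the predecessor set of \<open>x\<close> at \<open>N\<close> as a union of predecessor sets of points of
\<open>X\<close>. By non-decomposability one of these is the whole set, and mapping the corresponding point forward
yields a path that leaves the path of \<open>\<Phi> x\<close> and ends in the chosen non-decomposable part.

Soficity enters through the finiteness of the Krieger cover: it gives the decomposition into
non-decomposable vertices and makes the alphabets of the two edge shifts finite.\<close>

section \<open>Bi-infinite sequences and predecessor sets\<close>

definition translate :: "int \<Rightarrow> (int \<Rightarrow> 'a) \<Rightarrow> int \<Rightarrow> 'a" where
  "translate k x = (\<lambda>i. x (i + k))"

definition glue :: "(int \<Rightarrow> 'a) \<Rightarrow> int \<Rightarrow> (int \<Rightarrow> 'a) \<Rightarrow> int \<Rightarrow> 'a" where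
  "glue u n x = (\<lambda>i. if i < n then u i else x i)"

definition future :: "(int \<Rightarrow> 'a) \<Rightarrow> int \<Rightarrow> nat \<Rightarrow> 'a" where
  "future x n = (\<lambda>k. x (n + int k))"

definition past :: "(int \<Rightarrow> 'a) \<Rightarrow> int \<Rightarrow> nat \<Rightarrow> 'a" where
  "past x n = (\<lambda>k. x (n - 1 - int k))"

text \<open>Predecessor sets are attached to a position of a bi-infinite sequence rather than to a right ray.
Moving between rays and bi-infinite sequences, and with it all index translation, is then confined
to the next few lemmas; afterwards everything is expressed through \<open>glue\<close>.\<close>
definition pred_set :: "(int \<Rightarrow> 'a) set \<Rightarrow> (int \<Rightarrow> 'a) \<Rightarrow> int \<Rightarrow> 'a krieger_vertex" where
  "pred_set X x n = P_inf X (future x n)"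

definition krieger_path :: "(int \<Rightarrow> 'a) set \<Rightarrow> (int \<Rightarrow> 'a) \<Rightarrow> int \<Rightarrow> 'a krieger_edge" where
  "krieger_path X x = (\<lambda>i. (pred_set X x i, x i, pred_set X x (i + 1)))"

lemma translate_translate [simp]: "translate k (translate l x) = translate (k + l) x"
  by (auto simp: translate_def fun_eq_iff algebra_simps)

lemma translate_0 [simp]: "translate 0 x = x"
  by (simp add: translate_def)

lemma translate_apply: "translate k x i = x (i + k)"
  by (simp add: translate_def)

lemma glue_below [simp]: "i < n \<Longrightarrow> glue u n x i = u i"
  and glue_above [simp]: "n \<le> i \<Longrightarrow> glue u n x i = x i"
  by (auto simp: glue_def)

lemma glue_cong:
  "(\<And>i. i < n \<Longrightarrow> u i = u' i) \<Longrightarrow> (\<And>i. n \<le> i \<Longrightarrow> x i = x' i) \<Longrightarrow> glue u n x = glue u' n x'"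
  by (auto simp: glue_def fun_eq_iff)

lemma glue_eqI:
  "(\<And>i. i < n \<Longrightarrow> z i = u i) \<Longrightarrow> (\<And>i. n \<le> i \<Longrightarrow> z i = x i) \<Longrightarrow> glue u n x = z"
  by (auto simp: glue_def fun_eq_iff)

lemma future_cong: "(\<And>i. n \<le> i \<Longrightarrow> x i = x' i) \<Longrightarrow> future x n = future x' n"
  by (auto simp: future_def fun_eq_iff)

lemma pred_set_cong: "(\<And>i. n \<le> i \<Longrightarrow> x i = x' i) \<Longrightarrow> pred_set X x n = pred_set X x' n"
  unfolding pred_set_def using future_cong by metis

lemma past_surj: "\<exists>u. y = past u n"
  by (rule exI[of _ "\<lambda>i. y (nat (n - 1 - i))"]) (auto simp: past_def fun_eq_iff)

lemma join_rays_past_future: "join_rays (past u n) (future x n) = translate n (glue u n x)"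
  by (auto simp: join_rays_def past_def future_def glue_def translate_def fun_eq_iff
      intro!: arg_cong[of _ _ u] arg_cong[of _ _ x])

text \<open>The combinatorial content of being a shift space: invariance under all translations, and closedness
in the product topology expressed by finite windows.\<close>
locale subshift =
  fixes X :: "(int \<Rightarrow> 'a) set"
  assumes translate_mem: "x \<in> X \<Longrightarrow> translate k x \<in> X"
    and limit_mem: "(\<And>n::nat. \<exists>z\<in>X. \<forall>i\<in>{- int n..int n}. z i = x i) \<Longrightarrow> x \<in> X"
begin

lemma translate_iff: "translate k x \<in> X \<longleftrightarrow> x \<in> X"
  using translate_mem[of x k] translate_mem[of "translate k x" "- k"] by auto

lemma right_rays_eq: "right_rays X = (\<lambda>x. future x n) ` X"
proof -
  have "future x n \<in> right_rays X" if "x \<in> X" for x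
    unfolding right_rays_def
    by (rule image_eqI[OF _ translate_mem[OF that, of n]])
      (auto simp: future_def translate_def fun_eq_iff algebra_simps)
  moreover have "(\<lambda>k. x (int k)) \<in> (\<lambda>x. future x n) ` X" if "x \<in> X" for x
    by (rule image_eqI[OF _ translate_mem[OF that, of "- n"]])
      (auto simp: future_def translate_def fun_eq_iff algebra_simps)
  ultimately show ?thesis by (auto simp: right_rays_def)
qed

lemma past_in_left_rays: "x \<in> X \<Longrightarrow> past x n \<in> left_rays X"
  unfolding left_rays_def
  by (rule image_eqI[OF _ translate_mem[of x n]])
    (auto simp: past_def translate_def fun_eq_iff algebra_simps)

text \<open>A past is a left ray of \<open>X\<close> as soon as the glued sequence lies in \<open>X\<close>, so membership in a
predecessor set reduces to membership of a glued sequence.\<close>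
lemma past_in_pred_set: "past u n \<in> pred_set X x n \<longleftrightarrow> glue u n x \<in> X"
proof
  assume *: "glue u n x \<in> X"
  have "past (glue u n x) n = past u n"
    by (auto simp: past_def fun_eq_iff)
  with past_in_left_rays[OF *, of n] * show "past u n \<in> pred_set X x n"
    by (simp add: pred_set_def P_inf_def join_rays_past_future translate_iff)
qed (simp add: pred_set_def P_inf_def join_rays_past_future translate_iff)

lemma pred_set_subset_iff:
  "pred_set X x n \<subseteq> pred_set X x' n \<longleftrightarrow> (\<forall>u. glue u n x \<in> X \<longrightarrow> glue u n x' \<in> X)"
  unfolding subset_iff using past_in_pred_set past_surj by metis

lemma pred_set_eq_iff:
  "pred_set X x n = pred_set X x' n \<longleftrightarrow> (\<forall>u. glue u n x \<in> X \<longleftrightarrow> glue u n x' \<in> X)"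
  unfolding set_eq_subset pred_set_subset_iff by blast

lemma past_self: "x \<in> X \<Longrightarrow> past x n \<in> pred_set X x n"
  by (simp add: past_in_pred_set glue_def)

lemma pred_set_translate: "pred_set X (translate k x) n = pred_set X x (n + k)"
proof -
  have "future (translate k x) n = future x (n + k)"
    by (auto simp: future_def translate_def fun_eq_iff algebra_simps)
  then show ?thesis by (simp add: pred_set_def)
qed

lemma krieger_path_translate: "krieger_path X (translate k x) i = krieger_path X x (i + k)"
  by (simp add: krieger_path_def pred_set_translate translate_apply algebra_simps)

text \<open>Appending the letter at \<open>n\<close> to a past at \<open>n\<close> gives a past at \<open>n + 1\<close>, so a predecessor set is
determined by the next one and the letter between them.\<close>
lemma pred_set_step:
  assumes "pred_set X x (n + 1) = pred_set X x' (n + 1)" "x n = x' n"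
  shows "pred_set X x n = pred_set X x' n"
proof -
  have "glue u n z = glue (u(n := z n)) (n + 1) z" for u z :: "int \<Rightarrow> 'a"
    by (auto simp: glue_def fun_eq_iff)
  with assms show ?thesis unfolding pred_set_eq_iff by metis
qed

section \<open>Paths in the left Krieger cover\<close>

abbreviation "K \<equiv> left_krieger_cover X"

lemma verts_K: "verts K = (\<lambda>x. pred_set X x n) ` X"
  by (simp add: left_krieger_cover_def pred_set_def right_rays_eq[of n] image_image)

lemma tail_K: "tail K (P, a, P') = P" and head_K: "head K (P, a, P') = P'"
  by (simp_all add: left_krieger_cover_def)

text \<open>The position \<open>n\<close> is a free parameter: by translation invariance an edge may be realised wherever it
is needed along a path.\<close>
lemma arcs_K: "(P, a, P') \<in> arcs K \<longleftrightarrow>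
    (\<exists>x\<in>X. P = pred_set X x n \<and> a = x n \<and> P' = pred_set X x (n + 1))"
proof
  assume "(P, a, P') \<in> arcs K"
  then obtain r where r: "r \<in> right_rays X" "cons_ray a r \<in> right_rays X"
      "P = P_inf X (cons_ray a r)" "P' = P_inf X r"
    by (auto simp: left_krieger_cover_def)
  then obtain x where x: "x \<in> X" "cons_ray a r = future x n"
    by (auto simp: right_rays_eq[of n])
  have "a = x n" using fun_cong[OF x(2), of 0] by (simp add: cons_ray_def future_def)
  moreover have "r = future x (n + 1)"
  proof
    fix k show "r k = future x (n + 1) k"
      using fun_cong[OF x(2), of "Suc k"] by (simp add: cons_ray_def future_def algebra_simps)
  qed
  ultimately show "\<exists>x\<in>X. P = pred_set X x n \<and> a = x n \<and> P' = pred_set X x (n + 1)"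
    using r x by (auto simp: pred_set_def)
next
  assume "\<exists>x\<in>X. P = pred_set X x n \<and> a = x n \<and> P' = pred_set X x (n + 1)"
  then obtain x where x: "x \<in> X" "P = pred_set X x n" "a = x n" "P' = pred_set X x (n + 1)"
    by blast
  have "cons_ray a (future x (n + 1)) = future x n"
    by (auto simp: x cons_ray_def future_def fun_eq_iff algebra_simps split: nat.split)
  moreover have "future x (n + 1) \<in> right_rays X" "future x n \<in> right_rays X"
    using x(1) right_rays_eq[of "n + 1"] right_rays_eq[of n] by blast+
  ultimately show "(P, a, P') \<in> arcs K"
    unfolding left_krieger_cover_def pred_set_def x(2,4)
    by (simp, intro bexI[of _ "future x (n + 1)"]) simp_all
qed

lemma krieger_path_arc: "x \<in> X \<Longrightarrow> krieger_path X x i \<in> arcs K"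
  unfolding krieger_path_def arcs_K[where n = i] by blast

lemma krieger_path_in_edge_shift: "x \<in> X \<Longrightarrow> krieger_path X x \<in> edge_shift K"
  using krieger_path_arc by (auto simp: edge_shift_def krieger_path_def tail_K head_K)

text \<open>An edge ending at the predecessor set of \<open>x\<close> at \<open>n + 1\<close> is realised by some other point \<open>w\<close>. Since
the two predecessor sets coincide at \<open>n + 1\<close>, the past of \<open>w\<close> can be glued to the future of \<open>x\<close>.\<close>
lemma extend_backwards:
  assumes "x \<in> X" "(P, a, pred_set X x (n + 1)) \<in> arcs K"
  shows "\<exists>z\<in>X. pred_set X z n = P \<and> z n = a \<and> (\<forall>i>n. z i = x i)"
proof -
  obtain w where w: "w \<in> X" "P = pred_set X w n" "a = w n"
      "pred_set X x (n + 1) = pred_set X w (n + 1)"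
    using assms(2) arcs_K[where n = n] by blast
  define z where "z = glue w (n + 1) x"
  have "glue w (n + 1) w \<in> X" using w(1) by (simp add: glue_def)
  then have "z \<in> X" using w(4) by (auto simp: pred_set_eq_iff z_def)
  moreover have "pred_set X z (n + 1) = pred_set X w (n + 1)"
    unfolding w(4)[symmetric] by (rule pred_set_cong) (simp add: z_def)
  then have "pred_set X z n = pred_set X w n"
    by (rule pred_set_step) (simp add: z_def)
  moreover have "z n = a" "\<forall>i>n. z i = x i" by (simp_all add: z_def w(3))
  ultimately show ?thesis using w(2) by blast
qed

text \<open>The labels of a left-infinite path of the cover, followed by any ray whose predecessor set is the
terminal vertex, form a point of \<open>X\<close>, and this point traces the given path. Edges are added one
at a time by \<open>extend_backwards\<close>, and closedness gives the limit.\<close>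
lemma path_from_point:
  assumes \<xi>: "\<xi> \<in> edge_shift K" and x: "x \<in> X" and eq: "pred_set X x n = tail K (\<xi> n)"
  defines "z \<equiv> glue (covering_map krieger_label \<xi>) n x"
  shows "z \<in> X" "\<And>i. i < n \<Longrightarrow> krieger_path X z i = \<xi> i"
proof -
  define a where "a = covering_map krieger_label \<xi>"
  have \<xi>_eq: "\<xi> i = (tail K (\<xi> i), a i, tail K (\<xi> (i + 1)))" for i
  proof -
    obtain P b P' where e: "\<xi> i = (P, b, P')" by (cases "\<xi> i")
    have "head K (\<xi> i) = tail K (\<xi> (i + 1))" using \<xi> by (simp add: edge_shift_def)
    then show ?thesis
      by (simp add: e tail_K head_K a_def covering_map_def krieger_label_def)
  qed
  have arc: "\<xi> i \<in> arcs K" for i using \<xi> by (auto simp: edge_shift_def)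
  have approx: "\<exists>w\<in>X. (\<forall>i\<ge>n - int k. w i = z i) \<and> pred_set X w (n - int k) = tail K (\<xi> (n - int k))"
    for k
  proof (induction k)
    case 0
    show ?case using x eq by (intro bexI[of _ x]) (auto simp: z_def)
  next
    case (Suc k)
    then obtain w where w: "w \<in> X" "\<And>i. i \<ge> n - int k \<Longrightarrow> w i = z i"
        "pred_set X w (n - int k) = tail K (\<xi> (n - int k))" by blast
    define j where "j = n - int (Suc k)"
    have j: "j + 1 = n - int k" by (simp add: j_def)
    have "(tail K (\<xi> j), a j, pred_set X w (j + 1)) \<in> arcs K"
      using arc[of j] \<xi>_eq[of j] w(3) by (simp add: j)
    from extend_backwards[OF w(1) this] obtain w' where w': "w' \<in> X" "pred_set X w' j = tail K (\<xi> j)"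
        "w' j = a j" "\<And>i. i > j \<Longrightarrow> w' i = w i" by blast
    have "w' i = z i" if "i \<ge> j" for i
      using that w'(3,4) w(2)[of i] j by (cases "i = j") (auto simp: z_def a_def j_def)
    with w' show ?case unfolding j_def by blast
  qed
  show "z \<in> X"
  proof (rule limit_mem)
    fix m :: nat
    obtain w where "w \<in> X" "\<And>i. i \<ge> n - int (m + nat n) \<Longrightarrow> w i = z i"
      using approx[of "m + nat n"] by blast
    then show "\<exists>w\<in>X. \<forall>i\<in>{- int m..int m}. w i = z i" by (intro bexI[of _ w]) auto
  qed
  have pred: "pred_set X z i = tail K (\<xi> i)" if "i \<le> n" for i
  proof -
    have index: "n - int (nat (n - i)) = i" using that by simp
    obtain w where "\<And>j. j \<ge> i \<Longrightarrow> w j = z j" "pred_set X w i = tail K (\<xi> i)"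
      using approx[of "nat (n - i)"] unfolding index by blast
    then show ?thesis using pred_set_cong[of i w z] by simp
  qed
  show "krieger_path X z i = \<xi> i" if "i < n" for i
    using that pred[of i] pred[of "i + 1"] by (subst \<xi>_eq) (simp add: krieger_path_def z_def a_def)
qed

text \<open>The half-line is prolonged by any ray whose predecessor set is the vertex at \<open>n\<close>.\<close>
lemma path_approximation:
  assumes "\<xi> \<in> edge_shift K"
  shows "\<exists>z\<in>X. \<forall>i<n. krieger_path X z i = \<xi> i"
proof -
  have "\<xi> n \<in> arcs K" using assms by (auto simp: edge_shift_def)
  then obtain x where "x \<in> X" "pred_set X x n = tail K (\<xi> n)"
    using arcs_K[where n = n] by (cases "\<xi> n") (auto simp: tail_K)
  from path_from_point[OF assms this] show ?thesis by blast
qed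

lemma covering_map_mem:
  assumes "\<xi> \<in> edge_shift K"
  shows "covering_map krieger_label \<xi> \<in> X"
proof (rule limit_mem)
  fix n :: nat
  obtain z where z: "z \<in> X" "\<And>i. i < int n + 1 \<Longrightarrow> krieger_path X z i = \<xi> i"
    using path_approximation[OF assms] by blast
  then show "\<exists>z\<in>X. \<forall>i\<in>{- int n..int n}. z i = covering_map krieger_label \<xi> i"
    by (intro bexI[of _ z])
      (auto simp: covering_map_def krieger_label_def krieger_path_def simp flip: z(2))
qed

lemma krieger_path_label: "krieger_label (krieger_path X x i) = x i"
  by (simp add: krieger_label_def krieger_path_def)

lemma reachable_pred_set:
  assumes "x \<in> X" "i \<le> j"
  shows "reachable K (pred_set X x i) (pred_set X x j)"
  using assms(2)
proof (induction j rule: int_ge_induct)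
  case base
  show ?case using assms(1) by (auto simp: reachable_def verts_K[of i])
next
  case (step j)
  have "(pred_set X x j, pred_set X x (j + 1)) \<in> arcs_ends K"
    using krieger_path_arc[OF assms(1), of j] unfolding arcs_ends_def arc_to_ends_def
    by (auto simp: krieger_path_def image_iff tail_K head_K intro!: bexI)
  then show ?case using step assms(1)
    by (auto simp: reachable_def verts_K[of "j + 1"] intro: rtrancl_on_into_rtrancl_on)
qed

lemma reachable_realised:
  assumes "reachable K P P'"
  shows "\<exists>x\<in>X. \<exists>m\<ge>n. pred_set X x n = P \<and> pred_set X x m = P'"
  using assms unfolding reachable_def
proof (induction arbitrary: n rule: converse_rtrancl_on_induct)
  case base
  then show ?case by (auto simp: verts_K[of n])
next
  case (step P Q)
  obtain x m where x: "x \<in> X" "n + 1 \<le> m" "pred_set X x (n + 1) = Q" "pred_set X x m = P'"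
    using step.IH[of "n + 1"] by blast
  obtain a where "(P, a, Q) \<in> arcs K"
    using step.hyps(1) unfolding arcs_ends_def arc_to_ends_def
    by (force simp: tail_K head_K)
  then obtain z where z: "z \<in> X" "pred_set X z n = P" "\<And>i. i > n \<Longrightarrow> z i = x i"
    using extend_backwards[OF x(1), of P a n] x(3) by blast
  moreover have "pred_set X z m = P'"
    using x pred_set_cong[of m z x] z(3) by simp
  ultimately show ?case using x(2) by (intro bexI[of _ z] exI[of _ m]) auto
qed

text \<open>A decomposable vertex is a union of strictly smaller vertices, so induction on the number of
smaller vertices applies.\<close>
lemma union_of_non_decomposables:
  assumes fin: "finite (verts K)" and P: "P \<in> verts K"
  shows "P = \<Union> {Q. non_decomposable X Q \<and> Q \<subseteq> P}"
  using P
proof (induction "card {Q \<in> verts K. Q \<subset> P}" arbitrary: P rule: less_induct)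
  case less
  show ?case
  proof (cases "non_decomposable X P")
    case False
    then obtain V where V: "V \<subseteq> verts K" "P = \<Union>V" "P \<notin> V"
      using less.prems by (auto simp: non_decomposable_def)
    have "Q = \<Union> {R. non_decomposable X R \<and> R \<subseteq> Q}" if "Q \<in> V" for Q
    proof (rule less.hyps)
      have "Q \<subset> P" using V that by blast
      then show "card {R \<in> verts K. R \<subset> Q} < card {Q \<in> verts K. Q \<subset> P}"
        using V(1) that fin by (intro psubset_card_mono) auto
      show "Q \<in> verts K" using V that by blast
    qed
    then have "\<Union>V \<subseteq> \<Union> {R. non_decomposable X R \<and> R \<subseteq> P}"
      using V(2) by blast
    then show ?thesis using V(2) by blast
  qed blast
qed

section \<open>The generalized left Fischer cover\<close>

abbreviation "G \<equiv> generalized_left_fischer_cover X"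

definition fischer_vertex :: "'a krieger_vertex \<Rightarrow> bool" where
  "fischer_vertex P \<longleftrightarrow> (\<exists>P'. non_decomposable X P' \<and> reachable K P P')"

lemma fischer_vertex_backwards:
  "x \<in> X \<Longrightarrow> fischer_vertex (pred_set X x j) \<Longrightarrow> i \<le> j \<Longrightarrow> fischer_vertex (pred_set X x i)"
  unfolding fischer_vertex_def using reachable_pred_set[of x i j] unfolding reachable_def
  by (meson rtrancl_on_trans)

lemma edge_shift_G:
  "edge_shift G = {\<xi> \<in> edge_shift K. \<forall>i. fischer_vertex (tail K (\<xi> i))}"
proof -
  have "tail K e \<in> verts K" if "e \<in> arcs K" for e
    using that arcs_K[where n = 0] verts_K[of 0] by (cases e) (auto simp: tail_K)
  then have "tail K (\<xi> i) \<in> verts K" if "\<xi> \<in> edge_shift K" for \<xi> i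
    using that by (simp add: edge_shift_def)
  then show ?thesis
    by (auto simp: generalized_left_fischer_cover_def edge_shift_def induce_subgraph_def
        fischer_vertex_def)
qed

end

section \<open>Lifting a conjugacy to the left Krieger covers\<close>

text \<open>A conjugacy \<open>\<Phi>\<close> with inverse \<open>\<Psi>\<close>, both given by block maps with the window \<open>{- m..m}\<close>. The
description is symmetric, so that every result also holds with the roles of the two shift spaces
exchanged.\<close>
locale block_conjugacy = X: subshift X + Y: subshift Y
  for X :: "(int \<Rightarrow> 'a) set" and Y :: "(int \<Rightarrow> 'b) set" +
  fixes \<Phi> :: "(int \<Rightarrow> 'a) \<Rightarrow> int \<Rightarrow> 'b" and \<Psi> :: "(int \<Rightarrow> 'b) \<Rightarrow> int \<Rightarrow> 'a" and m :: int
  assumes m_nonneg: "0 \<le> m"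
    and \<Phi>_mem: "x \<in> X \<Longrightarrow> \<Phi> x \<in> Y" and \<Psi>_mem: "y \<in> Y \<Longrightarrow> \<Psi> y \<in> X"
    and \<Psi>_\<Phi>: "x \<in> X \<Longrightarrow> \<Psi> (\<Phi> x) = x" and \<Phi>_\<Psi>: "y \<in> Y \<Longrightarrow> \<Phi> (\<Psi> y) = y"
    and \<Phi>_translate: "x \<in> X \<Longrightarrow> \<Phi> (translate k x) = translate k (\<Phi> x)"
    and \<Psi>_translate: "y \<in> Y \<Longrightarrow> \<Psi> (translate k y) = translate k (\<Psi> y)"
    and \<Phi>_local: "\<lbrakk>x \<in> X; x' \<in> X; \<And>j. i - m \<le> j \<Longrightarrow> j \<le> i + m \<Longrightarrow> x j = x' j\<rbrakk> \<Longrightarrow> \<Phi> x i = \<Phi> x' i"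
    and \<Psi>_local: "\<lbrakk>y \<in> Y; y' \<in> Y; \<And>j. i - m \<le> j \<Longrightarrow> j \<le> i + m \<Longrightarrow> y j = y' j\<rbrakk> \<Longrightarrow> \<Psi> y i = \<Psi> y' i"
begin

lemma dual: "block_conjugacy Y X \<Psi> \<Phi> m"
  by unfold_locales (auto intro: m_nonneg \<Phi>_mem \<Psi>_mem \<Phi>_\<Psi> \<Psi>_\<Phi> \<Phi>_translate \<Psi>_translate \<Phi>_local \<Psi>_local)

text \<open>Let \<open>w\<close> be a past of \<open>\<Phi> x\<close> at \<open>n - 3 * m\<close>. Pulled back by \<open>\<Psi>\<close>, the glued sequence agrees with \<open>x\<close> from
\<open>n - 2 * m\<close> on, so its future at \<open>n\<close> may be replaced by that of \<open>x'\<close>. Mapping forward again gives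
the glued sequence left of \<open>n - m\<close>, where \<open>\<Phi> x\<close> and \<open>\<Phi> x'\<close> agree as far back as the past \<open>w\<close>, and
\<open>\<Phi> x'\<close> from \<open>n - m\<close> on.\<close>
lemma pred_set_image_subset:
  assumes x: "x \<in> X" and x': "x' \<in> X"
    and agree: "\<And>i. n - 4 * m \<le> i \<Longrightarrow> i < n \<Longrightarrow> x i = x' i"
    and eq: "pred_set X x n = pred_set X x' n"
  shows "pred_set Y (\<Phi> x) (n - 3 * m) \<subseteq> pred_set Y (\<Phi> x') (n - 3 * m)"
  unfolding Y.pred_set_subset_iff
proof (intro allI impI)
  fix w assume v: "glue w (n - 3 * m) (\<Phi> x) \<in> Y" (is "?v \<in> Y")
  have "\<Psi> ?v i = x i" if "n \<le> i" for i
    using that m_nonneg \<Psi>_local[OF v \<Phi>_mem[OF x], of i] \<Psi>_\<Phi>[OF x] by auto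
  then have "glue (\<Psi> ?v) n x = \<Psi> ?v" by (intro glue_eqI) auto
  then have t: "glue (\<Psi> ?v) n x' \<in> X" (is "?t \<in> X")
    using eq \<Psi>_mem[OF v] unfolding X.pred_set_eq_iff by metis
  have t_x': "?t i = x' i" if "n - 2 * m \<le> i" for i
    using that m_nonneg agree[of i] \<Psi>_local[OF v \<Phi>_mem[OF x], of i] \<Psi>_\<Phi>[OF x]
    by (cases "i < n") auto
  have low: "\<Phi> ?t i = ?v i" if "i < n - m" for i
    using that \<Phi>_local[OF t \<Psi>_mem[OF v], of i] \<Phi>_\<Psi>[OF v] by auto
  have mid: "\<Phi> x i = \<Phi> x' i" if "n - 3 * m \<le> i" "i < n - m" for i
    using that \<Phi>_local[OF x x', of i] agree by auto
  have high: "\<Phi> ?t i = \<Phi> x' i" if "n - m \<le> i" for i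
    using that \<Phi>_local[OF t x', of i] t_x' by auto
  have "glue w (n - 3 * m) (\<Phi> x') = \<Phi> ?t"
  proof (rule glue_eqI)
    fix i assume "i < n - 3 * m"
    then show "\<Phi> ?t i = w i" using low[of i] m_nonneg by auto
  next
    fix i assume "n - 3 * m \<le> i"
    then show "\<Phi> ?t i = \<Phi> x' i" using low[of i] mid[of i] high[of i]
      by (cases "i < n - m") auto
  qed
  then show "glue w (n - 3 * m) (\<Phi> x') \<in> Y" using \<Phi>_mem[OF t] by simp
qed

lemma pred_set_image:
  assumes "x \<in> X" "x' \<in> X" "\<And>i. n - 4 * m \<le> i \<Longrightarrow> i < n \<Longrightarrow> x i = x' i"
    and "pred_set X x n = pred_set X x' n"
  shows "pred_set Y (\<Phi> x) (n - 3 * m) = pred_set Y (\<Phi> x') (n - 3 * m)"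
  using assms by (intro equalityI pred_set_image_subset) auto

lemma krieger_path_image:
  assumes x: "x \<in> X" and x': "x' \<in> X"
    and agree: "\<And>j. i - 3 * m \<le> j \<Longrightarrow> j \<le> i + 3 * m \<Longrightarrow> krieger_path X x j = krieger_path X x' j"
  shows "krieger_path Y (\<Phi> x) i = krieger_path Y (\<Phi> x') i"
proof -
  have letters: "x j = x' j" if "i - 3 * m \<le> j" "j \<le> i + 3 * m" for j
    using agree[OF that] by (simp add: krieger_path_def)
  have "pred_set X x (i + 3 * m + 1) = pred_set X x' (i + 3 * m + 1)"
    using agree[of "i + 3 * m"] m_nonneg by (simp add: krieger_path_def)
  then have "pred_set Y (\<Phi> x) (i + 1) = pred_set Y (\<Phi> x') (i + 1)"
    using pred_set_image[OF x x', of "i + 3 * m + 1"] letters m_nonneg by simp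
  moreover have "\<Phi> x i = \<Phi> x' i"
    using letters m_nonneg by (intro \<Phi>_local[OF x x']) auto
  ultimately show ?thesis
    using Y.pred_set_step[of "\<Phi> x" i "\<Phi> x'"] by (simp add: krieger_path_def)
qed

text \<open>The extension of \<open>krieger_path X x \<mapsto> krieger_path Y (\<Phi> x)\<close> to the whole edge shift, letter by letter:
by \<open>krieger_path_image\<close> the choice of the point approximating \<open>\<xi>\<close> around \<open>i\<close> is irrelevant.\<close>
definition lift :: "(int \<Rightarrow> 'a krieger_edge) \<Rightarrow> int \<Rightarrow> 'b krieger_edge" where
  "lift \<xi> = (\<lambda>i. krieger_path Y
     (\<Phi> (SOME z. z \<in> X \<and> (\<forall>j\<in>{i - 3 * m..i + 3 * m}. krieger_path X z j = \<xi> j))) i)"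

lemma lift_eq:
  assumes "z \<in> X" "\<And>j. i - 3 * m \<le> j \<Longrightarrow> j \<le> i + 3 * m \<Longrightarrow> krieger_path X z j = \<xi> j"
  shows "lift \<xi> i = krieger_path Y (\<Phi> z) i"
proof -
  let ?Q = "\<lambda>z. z \<in> X \<and> (\<forall>j\<in>{i - 3 * m..i + 3 * m}. krieger_path X z j = \<xi> j)"
  have "?Q (SOME z. ?Q z)" using assms by (intro someI[of ?Q z]) auto
  then show ?thesis unfolding lift_def using assms by (intro krieger_path_image) auto
qed

lemma lift_local:
  assumes "\<xi> \<in> edge_shift X.K" "\<And>j. i - 3 * m \<le> j \<Longrightarrow> j \<le> i + 3 * m \<Longrightarrow> \<xi> j = \<xi>' j"
  shows "lift \<xi> i = lift \<xi>' i"
proof -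
  obtain z where "z \<in> X" "\<forall>j<i + 3 * m + 1. krieger_path X z j = \<xi> j"
    using X.path_approximation[OF assms(1)] by blast
  then show ?thesis using assms(2) lift_eq[of z i \<xi>] lift_eq[of z i \<xi>'] by simp
qed

text \<open>One point of \<open>X\<close> describes both \<open>\<xi>\<close> and its lift on a left half-line; most properties of the lift
are read off from it.\<close>
lemma lift_approximation:
  assumes "\<xi> \<in> edge_shift X.K"
  shows "\<exists>z\<in>X. (\<forall>i<n + 3 * m. krieger_path X z i = \<xi> i) \<and>
    (\<forall>i<n. lift \<xi> i = krieger_path Y (\<Phi> z) i)"
proof -
  obtain z where z: "z \<in> X" "\<And>i. i < n + 3 * m \<Longrightarrow> krieger_path X z i = \<xi> i"
    using X.path_approximation[OF assms] by blast
  have "lift \<xi> i = krieger_path Y (\<Phi> z) i" if "i < n" for i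
    using z that by (intro lift_eq) auto
  with z show ?thesis by blast
qed

lemma lift_mem:
  assumes "\<xi> \<in> edge_shift X.K"
  shows "lift \<xi> \<in> edge_shift Y.K"
proof -
  have "lift \<xi> i \<in> arcs Y.K \<and> head Y.K (lift \<xi> i) = tail Y.K (lift \<xi> (i + 1))" for i
  proof -
    obtain z where "z \<in> X" "\<And>j. j < i + 2 \<Longrightarrow> lift \<xi> j = krieger_path Y (\<Phi> z) j"
      using lift_approximation[OF assms] by blast
    then show ?thesis using Y.krieger_path_in_edge_shift[OF \<Phi>_mem[of z]]
      by (auto simp: edge_shift_def)
  qed
  then show ?thesis by (auto simp: edge_shift_def)
qed

lemma lift_shift:
  assumes "\<xi> \<in> edge_shift X.K"
  shows "lift (shift \<xi>) = shift (lift \<xi>)"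
proof
  fix i
  obtain z where z: "z \<in> X" "\<And>j. j < i + 2 + 3 * m \<Longrightarrow> krieger_path X z j = \<xi> j"
      "\<And>j. j < i + 2 \<Longrightarrow> lift \<xi> j = krieger_path Y (\<Phi> z) j"
    using lift_approximation[OF assms] by blast
  have "lift (shift \<xi>) i = krieger_path Y (\<Phi> (translate 1 z)) i"
    using z(1,2) by (intro lift_eq) (auto simp: X.translate_mem X.krieger_path_translate shift_def)
  also have "\<dots> = krieger_path Y (\<Phi> z) (i + 1)"
    by (simp add: \<Phi>_translate z(1) Y.krieger_path_translate)
  finally show "lift (shift \<xi>) i = shift (lift \<xi>) i" by (simp add: shift_def z(3))
qed

lemma covering_map_lift:
  assumes "\<xi> \<in> edge_shift X.K"
  shows "\<Phi> (covering_map krieger_label \<xi>) = covering_map krieger_label (lift \<xi>)"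
proof
  fix i
  obtain z where z: "z \<in> X" "\<And>j. j < i + 1 + 3 * m \<Longrightarrow> krieger_path X z j = \<xi> j"
      "\<And>j. j < i + 1 \<Longrightarrow> lift \<xi> j = krieger_path Y (\<Phi> z) j"
    using lift_approximation[OF assms] by blast
  have "\<Phi> (covering_map krieger_label \<xi>) i = \<Phi> z i"
  proof (rule \<Phi>_local[OF X.covering_map_mem[OF assms] z(1)])
    fix j assume "j \<le> i + m"
    then show "covering_map krieger_label \<xi> j = z j"
      using z(2)[of j] m_nonneg X.krieger_path_label[of z j] by (simp add: covering_map_def)
  qed
  then show "\<Phi> (covering_map krieger_label \<xi>) i = covering_map krieger_label (lift \<xi>) i"
    by (simp add: covering_map_def z(3) Y.krieger_path_label)
qed

lemma dual_lift:
  assumes "\<xi> \<in> edge_shift X.K"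
  shows "block_conjugacy.lift Y X \<Psi> m (lift \<xi>) = \<xi>"
proof
  interpret D: block_conjugacy Y X \<Psi> \<Phi> m by (rule dual)
  fix i
  obtain z where z: "z \<in> X" "\<And>j. j < i + 1 + 3 * m + 3 * m \<Longrightarrow> krieger_path X z j = \<xi> j"
      "\<And>j. j < i + 1 + 3 * m \<Longrightarrow> lift \<xi> j = krieger_path Y (\<Phi> z) j"
    using lift_approximation[OF assms] by blast
  have "D.lift (lift \<xi>) i = krieger_path X (\<Psi> (\<Phi> z)) i"
    using z(3) by (intro D.lift_eq \<Phi>_mem z(1)) auto
  then show "D.lift (lift \<xi>) i = \<xi> i"
    using z(2)[of i] m_nonneg by (simp add: \<Psi>_\<Phi> z(1))
qed

section \<open>The lift respects the generalized left Fischer covers\<close>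

text \<open>The non-decomposable vertices contained in the predecessor set of \<open>\<Phi> x\<close> at \<open>L = N + 3 * m\<close> are the
predecessor sets of points \<open>u\<close>. Replacing the future of \<open>\<Phi> x\<close> at \<open>L\<close> by that of \<open>u\<close> and mapping back
gives a point \<open>z\<close> of \<open>X\<close>, provided that some past makes this replacement possible. The future of
\<open>z\<close> at \<open>N\<close> depends on \<open>u\<close> only, and the predecessor sets of these \<open>z\<close> at \<open>N\<close> have the predecessor
set of \<open>x\<close> as their union. Non-decomposability singles out one \<open>z\<close> that has the same predecessor set
at \<open>N\<close> as \<open>x\<close>. Gluing the past of \<open>x\<close> to it gives a point whose image has, at \<open>N - 3 * m\<close>, the same
predecessor set as \<open>\<Phi> x\<close>, and, at \<open>L\<close>, the non-decomposable predecessor set of \<open>u\<close>.\<close>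
lemma fischer_vertex_image:
  assumes fin: "finite (verts Y.K)"
    and x: "x \<in> X" and nd: "non_decomposable X (pred_set X x N)"
  shows "Y.fischer_vertex (pred_set Y (\<Phi> x) (N - 3 * m))"
proof -
  define L where "L = N + 3 * m"
  define U where "U = {u \<in> Y. non_decomposable Y (pred_set Y u L) \<and> pred_set Y u L \<subseteq> pred_set Y (\<Phi> x) L}"
  \<comment> \<open>The sequence \<open>s\<close> is \<open>x\<close> with another past at \<open>N\<close>, and \<open>z\<close> comes from \<open>s\<close> by replacing the
    future of its image at \<open>L\<close> by that of \<open>u\<close>.\<close>
  define good where "good u s z \<longleftrightarrow> u \<in> U \<and> s \<in> X \<and> (\<forall>i\<ge>N. s i = x i) \<and>
      glue (\<Phi> s) L u \<in> Y \<and> z = \<Psi> (glue (\<Phi> s) L u)" for u s z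
  have L: "N + 3 * m \<le> L" by (simp add: L_def)
  have L': "N - 3 * m \<le> L" using L m_nonneg by simp
  have cover: "\<exists>u\<in>U. glue v L u \<in> Y" if v: "glue v L (\<Phi> x) \<in> Y" for v
  proof -
    have "pred_set Y (\<Phi> x) L \<in> verts Y.K" using \<Phi>_mem[OF x] by (auto simp: Y.verts_K[of L])
    note decomposition = Y.union_of_non_decomposables[OF fin this]
    have "past v L \<in> pred_set Y (\<Phi> x) L" using v by (simp add: Y.past_in_pred_set)
    then obtain Q where Q: "past v L \<in> Q" "non_decomposable Y Q" "Q \<subseteq> pred_set Y (\<Phi> x) L"
      by (subst (asm) decomposition) (elim UnionE CollectE conjE)
    then obtain u where "u \<in> Y" "Q = pred_set Y u L"
      by (auto simp: non_decomposable_def Y.verts_K[of L])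
    with Q show ?thesis by (auto simp: U_def Y.past_in_pred_set)
  qed
  have \<Phi>_tail: "\<Phi> s i = \<Phi> x i" if "s \<in> X" "\<And>i. i \<ge> N \<Longrightarrow> s i = x i" "N + m \<le> i" for s i
    using that by (intro \<Phi>_local x) auto
  have good_mem: "z \<in> X" and good_\<Phi>: "\<Phi> z = glue (\<Phi> s) L u" if "good u s z" for u s z
    using that \<Psi>_mem \<Phi>_\<Psi> by (auto simp: good_def)
  have good_tail: "\<Phi> z j = (if j < L then \<Phi> x j else u j)" if "good u s z" "N + m \<le> j" for u s z j
  proof -
    have "\<Phi> s j = \<Phi> x j" using that by (intro \<Phi>_tail) (auto simp: good_def)
    then show ?thesis by (simp add: good_\<Phi>[OF that(1)] glue_def)
  qed
  have good_low: "z i = s i" if "good u s z" "i < L - m" for u s z i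
    using that \<Psi>_local[of "glue (\<Phi> s) L u" "\<Phi> s" i] \<Phi>_mem[of s] \<Psi>_\<Phi>[of s] by (auto simp: good_def)
  \<comment> \<open>Left of \<open>L - m\<close> both points carry the letters of \<open>x\<close>; from \<open>N + 2 * m\<close> on they are
    determined by their images, which agree from \<open>N + m\<close> on. The choice of \<open>L\<close> makes these two
    ranges meet.\<close>
  have good_unique: "z i = z' i" if g: "good u s z" and g': "good u s' z'" and "N \<le> i" for u s s' z z' i
  proof (cases "i < L - m")
    case True
    then show ?thesis using good_low[OF g] good_low[OF g'] g g' that by (auto simp: good_def)
  next
    case False
    have "\<Phi> z j = \<Phi> z' j" if "N + m \<le> j" for j
      using good_tail[OF g that] good_tail[OF g' that] by simp
    then have "\<Psi> (\<Phi> z) i = \<Psi> (\<Phi> z') i"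
      using False L by (intro \<Psi>_local \<Phi>_mem good_mem[OF g] good_mem[OF g']) auto
    then show ?thesis by (simp add: \<Psi>_\<Phi> good_mem[OF g] good_mem[OF g'])
  qed
  have good_exists: "\<exists>u z. good u (glue t N x) z" if s: "glue t N x \<in> X" (is "?s \<in> X") for t
  proof -
    have "\<Phi> ?s i = \<Phi> x i" if "L \<le> i" for i
      using \<Phi>_tail[OF s, of i] that L m_nonneg by simp
    then have "glue (\<Phi> ?s) L (\<Phi> x) = \<Phi> ?s" by (intro glue_eqI) auto
    then obtain u where "u \<in> U" "glue (\<Phi> ?s) L u \<in> Y" using cover \<Phi>_mem[OF s] by metis
    then show ?thesis using s by (auto simp: good_def)
  qed
  have "pred_set X x N = \<Union> {pred_set X z N | u s z. good u s z}"
  proof (intro equalityI subsetI)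
    fix r assume r: "r \<in> pred_set X x N"
    obtain t where t: "r = past t N" using past_surj by blast
    have "glue t N x \<in> X" using r by (simp add: t X.past_in_pred_set)
    from good_exists[OF this] obtain u z where g: "good u (glue t N x) z" by blast
    have "glue t N z = z"
      using good_low[OF g] L m_nonneg by (intro glue_eqI) auto
    then have "r \<in> pred_set X z N" using good_mem[OF g] by (simp add: t X.past_in_pred_set)
    with g show "r \<in> \<Union> {pred_set X z N | u s z. good u s z}" by blast
  next
    fix r assume "r \<in> \<Union> {pred_set X z N | u s z. good u s z}"
    then obtain u s z where g: "good u s z" and r: "r \<in> pred_set X z N" by blast
    obtain w where w: "r = past w N" using past_surj by blast
    have p: "glue w N z \<in> X" (is "?p \<in> X") using r by (simp add: w X.past_in_pred_set)
    have \<Phi>p: "\<Phi> ?p i = \<Phi> z i" if "N + m \<le> i" for i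
      using that by (intro \<Phi>_local p good_mem[OF g]) auto
    have "glue (\<Phi> ?p) L u = \<Phi> ?p"
      using \<Phi>p L m_nonneg by (intro glue_eqI) (auto simp: good_\<Phi>[OF g])
    then have "past (\<Phi> ?p) L \<in> pred_set Y u L"
      using \<Phi>_mem[OF p] by (simp add: Y.past_in_pred_set)
    then have "past (\<Phi> ?p) L \<in> pred_set Y (\<Phi> x) L"
      using g by (auto simp: good_def U_def)
    then have q: "glue (\<Phi> ?p) L (\<Phi> x) \<in> Y" (is "?q \<in> Y")
      by (simp add: Y.past_in_pred_set)
    have "\<Psi> ?q = glue w N x"
    proof (rule glue_eqI[symmetric])
      have low: "\<Psi> ?q i = ?p i" if "i < L - m" for i
        using that \<Psi>_local[OF q \<Phi>_mem[OF p], of i] \<Psi>_\<Phi>[OF p] by auto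
      fix i
      show "\<Psi> ?q i = w i" if "i < N" using low[of i] that L m_nonneg by auto
      assume "N \<le> i"
      show "\<Psi> ?q i = x i"
      proof (cases "i < L - m")
        case True
        then show ?thesis using low[of i] good_low[OF g] g \<open>N \<le> i\<close> by (auto simp: good_def)
      next
        case False
        have "?q j = \<Phi> x j" if "N + m \<le> j" for j
          using \<Phi>p[OF that] good_tail[OF g that] by (simp add: glue_def)
        then have "\<Psi> ?q i = \<Psi> (\<Phi> x) i"
          using False L by (intro \<Psi>_local q \<Phi>_mem[OF x]) auto
        then show ?thesis by (simp add: \<Psi>_\<Phi>[OF x])
      qed
    qed
    then show "r \<in> pred_set X x N" using \<Psi>_mem[OF q] by (simp add: w X.past_in_pred_set)
  qed
  moreover have "{pred_set X z N | u s z. good u s z} \<subseteq> verts X.K"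
    using good_mem by (auto simp: X.verts_K[of N])
  ultimately have "pred_set X x N \<in> {pred_set X z N | u s z. good u s z}"
    using nd unfolding non_decomposable_def by blast
  then obtain u s z where g: "good u s z" and eq: "pred_set X x N = pred_set X z N" by blast
  have h: "glue x N z \<in> X" (is "?h \<in> X")
    using X.past_self[OF x, of N] by (simp add: eq X.past_in_pred_set)
  have "pred_set X ?h N = pred_set X x N"
    unfolding eq by (rule pred_set_cong) simp
  then have "pred_set Y (\<Phi> ?h) (N - 3 * m) = pred_set Y (\<Phi> x) (N - 3 * m)"
    by (intro pred_set_image h x) auto
  moreover have "pred_set Y (\<Phi> ?h) L = pred_set Y u L"
  proof (rule pred_set_cong)
    fix i assume "L \<le> i"
    then have "\<Phi> ?h i = \<Phi> z i" using L m_nonneg by (intro \<Phi>_local h good_mem[OF g]) auto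
    then show "\<Phi> ?h i = u i" using \<open>L \<le> i\<close> by (simp add: good_\<Phi>[OF g])
  qed
  moreover have "non_decomposable Y (pred_set Y u L)" using g by (auto simp: good_def U_def)
  ultimately show ?thesis
    using Y.reachable_pred_set[OF \<Phi>_mem[OF h] L'] unfolding Y.fischer_vertex_def by auto
qed

text \<open>A vertex of \<open>\<xi>\<close> far to the right reaches a non-decomposable vertex. Following \<open>\<xi>\<close> up to there and then
leaving it towards the non-decomposable vertex yields the path of a point to which
\<open>fischer_vertex_image\<close> applies, and up to the chosen position its lift is that of \<open>\<xi>\<close>.\<close>
lemma lift_fischer:
  assumes fin: "finite (verts Y.K)" and \<xi>: "\<xi> \<in> edge_shift X.G"
  shows "lift \<xi> \<in> edge_shift Y.G"
proof -
  have \<xi>K: "\<xi> \<in> edge_shift X.K" using \<xi> by (simp add: X.edge_shift_G)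
  have "Y.fischer_vertex (tail Y.K (lift \<xi> i))" for i
  proof -
    define n where "n = i + 1 + 3 * m"
    obtain P where P: "non_decomposable X P" "reachable X.K (tail X.K (\<xi> n)) P"
      using \<xi> by (auto simp: X.edge_shift_G X.fischer_vertex_def)
    obtain x N where x: "x \<in> X" "n \<le> N" "pred_set X x n = tail X.K (\<xi> n)" "pred_set X x N = P"
      using X.reachable_realised[OF P(2)] by blast
    define z where "z = glue (covering_map krieger_label \<xi>) n x"
    have z: "z \<in> X" "\<And>j. j < n \<Longrightarrow> krieger_path X z j = \<xi> j"
      using X.path_from_point[OF \<xi>K x(1,3)] by (simp_all add: z_def)
    have "pred_set X z N = P"
      using x(2,4) pred_set_cong[of N z x] by (simp add: z_def)
    then have "Y.fischer_vertex (pred_set Y (\<Phi> z) (N - 3 * m))"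
      using P(1) by (intro fischer_vertex_image fin z(1)) simp
    then have "Y.fischer_vertex (pred_set Y (\<Phi> z) i)"
      by (rule Y.fischer_vertex_backwards[OF \<Phi>_mem[OF z(1)]]) (use x(2) in \<open>simp add: n_def\<close>)
    moreover have "lift \<xi> i = krieger_path Y (\<Phi> z) i"
      using z by (intro lift_eq) (auto simp: n_def)
    ultimately show ?thesis by (simp add: krieger_path_def Y.tail_K)
  qed
  then show ?thesis using lift_mem[OF \<xi>K] by (simp add: Y.edge_shift_G)
qed

lemma bij_betw_lift:
  assumes "finite (verts X.K)" "finite (verts Y.K)"
  shows "bij_betw lift (edge_shift X.G) (edge_shift Y.G)"
proof -
  interpret D: block_conjugacy Y X \<Psi> \<Phi> m by (rule dual)
  show ?thesis
    by (rule bij_betwI[where g = D.lift])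
      (use assms lift_fischer D.lift_fischer dual_lift D.dual_lift
        in \<open>auto simp: X.edge_shift_G Y.edge_shift_G\<close>)
qed

end

section \<open>Shift spaces as topological spaces\<close>

lemma topspace_full_shift: "topspace (full_shift A) = {x. \<forall>i. x i \<in> A}"
  by (auto simp: full_shift_def)

lemma openin_full_shift:
  "openin (full_shift A) U \<longleftrightarrow> U \<subseteq> topspace (full_shift A) \<and>
     (\<forall>x\<in>U. \<exists>n::nat. \<forall>z\<in>topspace (full_shift A). (\<forall>i\<in>{- int n..int n}. z i = x i) \<longrightarrow> z \<in> U)"
  (is "?open \<longleftrightarrow> _ \<and> (\<forall>x\<in>U. ?cyl x)")
proof (intro iffI conjI ballI)
  assume U: ?open
  show "U \<subseteq> topspace (full_shift A)" using U by (rule openin_subset)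
  fix x assume "x \<in> U"
  then obtain V where V: "finite {i. V i \<noteq> A}" "\<And>i. V i \<subseteq> A" "x \<in> Pi\<^sub>E UNIV V" "Pi\<^sub>E UNIV V \<subseteq> U"
    using U by (auto simp: full_shift_def openin_product_topology_alt)
  obtain n :: nat where n: "nat ` abs ` {i. V i \<noteq> A} \<subseteq> {..n}"
    using V(1) finite_nat_set_iff_bounded_le[of "nat ` abs ` {i. V i \<noteq> A}"] by auto
  show "?cyl x"
  proof (intro exI[of _ n] ballI impI)
    fix z assume z: "z \<in> topspace (full_shift A)" "\<forall>i\<in>{- int n..int n}. z i = x i"
    have "z i \<in> V i" for i
    proof (cases "V i = A")
      case True
      then show ?thesis using z(1) by (simp add: topspace_full_shift)
    next
      case False
      then have "nat \<bar>i\<bar> \<le> n" using n by auto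
      then have "i \<in> {- int n..int n}" by auto
      then have "z i = x i" using z(2) by blast
      then show ?thesis using V(3) by auto
    qed
    then show "z \<in> U" using V(4) by auto
  qed
next
  assume *: "U \<subseteq> topspace (full_shift A) \<and> (\<forall>x\<in>U. ?cyl x)"
  show ?open unfolding full_shift_def openin_product_topology_alt
  proof
    fix x assume x: "x \<in> U"
    then obtain n :: nat
      where n: "\<And>z. z \<in> topspace (full_shift A) \<Longrightarrow> \<forall>i\<in>{- int n..int n}. z i = x i \<Longrightarrow> z \<in> U"
      using * by blast
    define V where "V i = (if i \<in> {- int n..int n} then {x i} else A)" for i
    have xA: "x i \<in> A" for i using x * by (auto simp: topspace_full_shift)
    have "finite {i \<in> UNIV. V i \<noteq> topspace (discrete_topology A)}"
      by (rule finite_subset[of _ "{- int n..int n}"]) (auto simp: V_def)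
    moreover have "Pi\<^sub>E UNIV V \<subseteq> U"
    proof
      fix z assume "z \<in> Pi\<^sub>E UNIV V"
      then have z: "z i \<in> V i" for i by auto
      have "z i \<in> A" for i using z[of i] xA by (auto simp: V_def split: if_splits)
      moreover have "z i = x i" if "i \<in> {- int n..int n}" for i using z[of i] that by (simp add: V_def)
      ultimately show "z \<in> U" by (intro n) (auto simp: topspace_full_shift)
    qed
    ultimately show "\<exists>V. finite {i \<in> UNIV. V i \<noteq> topspace (discrete_topology A)} \<and>
        (\<forall>i\<in>UNIV. openin (discrete_topology A) (V i)) \<and> x \<in> Pi\<^sub>E UNIV V \<and> Pi\<^sub>E UNIV V \<subseteq> U"
      using xA by (intro exI[of _ V]) (auto simp: V_def)
  qed
qed

lemma shift_eq_translate: "shift x = translate 1 x"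
  by (simp add: shift_def translate_def)

lemma shift_space_letters: "shift_space A X \<Longrightarrow> x \<in> X \<Longrightarrow> x i \<in> A"
  using closedin_subset[of "full_shift A" X] by (auto simp: shift_space_def topspace_full_shift)

lemma shift_space_translate:
  assumes "shift_space A X" "x \<in> X"
  shows "translate k x \<in> X"
proof -
  have eq: "shift ` X = X" using assms(1) by (simp add: shift_space_def)
  show ?thesis
  proof (induction k rule: int_induct[where k = 0])
    case (step1 i)
    have "translate (i + 1) x = shift (translate i x)"
      by (simp add: shift_eq_translate add.commute)
    then show ?case using step1 eq by blast
  next
    case (step2 i)
    then obtain y where "y \<in> X" "translate i x = shift y" using eq by blast
    then have "translate (- 1) (translate i x) = y" by (simp add: shift_eq_translate)
    then show ?case using \<open>y \<in> X\<close> by simp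
  qed (use assms in simp)
qed

lemma shift_space_imp_subshift:
  assumes "shift_space A X"
  shows "subshift X"
proof
  fix x k assume "x \<in> X"
  then show "translate k x \<in> X" using assms shift_space_translate by blast
next
  fix x assume lim: "\<And>n::nat. \<exists>z\<in>X. \<forall>i\<in>{- int n..int n}. z i = x i"
  have "x i \<in> A" for i
  proof -
    have "i \<in> {- int (nat \<bar>i\<bar>)..int (nat \<bar>i\<bar>)}" by auto
    then obtain z where "z \<in> X" "z i = x i"
      using lim[of "nat \<bar>i\<bar>"] by blast
    then show ?thesis using shift_space_letters[OF assms] by metis
  qed
  then have xA: "x \<in> topspace (full_shift A)" by (simp add: topspace_full_shift)
  show "x \<in> X"
  proof (rule ccontr)
    assume "x \<notin> X"
    have "openin (full_shift A) (topspace (full_shift A) - X)"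
      using assms by (auto simp: shift_space_def)
    then obtain n :: nat
      where "\<And>z. z \<in> topspace (full_shift A) \<Longrightarrow> \<forall>i\<in>{- int n..int n}. z i = x i \<Longrightarrow> z \<notin> X"
      using xA \<open>x \<notin> X\<close> unfolding openin_full_shift by blast
    then show False
      using lim[of n] shift_space_letters[OF assms] by (auto simp: topspace_full_shift)
  qed
qed

lemma compact_space_shift_space:
  assumes "shift_space A X"
  shows "compactin (full_shift A) X"
proof -
  have "compact_space (full_shift A)"
    using assms by (auto simp: full_shift_def shift_space_def compact_space_product_topology
        compact_space_discrete_topology)
  then show ?thesis using assms by (auto simp: shift_space_def intro: closedin_compact_space)
qed

section \<open>Continuous maps are block maps\<close>

definition block_map :: "(int \<Rightarrow> 'a) set \<Rightarrow> int \<Rightarrow> ((int \<Rightarrow> 'a) \<Rightarrow> int \<Rightarrow> 'b) \<Rightarrow> bool" where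
  "block_map X m f \<longleftrightarrow>
     (\<forall>x\<in>X. \<forall>x'\<in>X. \<forall>i. (\<forall>j. i - m \<le> j \<longrightarrow> j \<le> i + m \<longrightarrow> x j = x' j) \<longrightarrow> f x i = f x' i)"

lemma block_map_apply:
  "\<lbrakk>block_map X m f; x \<in> X; x' \<in> X; \<And>j. i - m \<le> j \<Longrightarrow> j \<le> i + m \<Longrightarrow> x j = x' j\<rbrakk> \<Longrightarrow> f x i = f x' i"
  unfolding block_map_def by blast

lemma block_map_mono: "block_map X m f \<Longrightarrow> m \<le> m' \<Longrightarrow> block_map X m' f"
  unfolding block_map_def by (smt (verit))

lemma shift_commute_translate:
  assumes X: "shift_space A X" and f: "\<And>x. x \<in> X \<Longrightarrow> f (shift x) = shift (f x)" and x: "x \<in> X"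
  shows "f (translate k x) = translate k (f x)"
proof (induction k rule: int_induct[where k = 0])
  case (step1 i)
  have "f (translate (i + 1) x) = f (shift (translate i x))"
    by (simp add: shift_eq_translate add.commute)
  then show ?case
    using step1 f[OF shift_space_translate[OF X x, of i]] by (simp add: shift_eq_translate add.commute)
next
  case (step2 i)
  have "translate i (f x) = f (shift (translate (i - 1) x))"
    using step2 by (simp add: shift_eq_translate)
  also have "\<dots> = translate 1 (f (translate (i - 1) x))"
    using f[OF shift_space_translate[OF X x, of "i - 1"]] by (simp add: shift_eq_translate)
  finally have "translate (- 1) (translate i (f x)) = f (translate (i - 1) x)" by simp
  then show ?case by simp
qed simp

text \<open>The theorem of Curtis, Hedlund and Lyndon. The open sets \<open>U n\<close> of all sequences whose central window of
radius \<open>n\<close> determines the letter at \<open>0\<close> of the image increase with \<open>n\<close> and cover the compact set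
\<open>X\<close>, so a single one contains it; translation carries the result to all positions.\<close>
lemma shift_morphism_block_map:
  assumes "shift_morphism A X B Y f"
  shows "\<exists>m\<ge>0. block_map X m f"
proof -
  have X: "shift_space A X" and Y: "shift_space B Y"
    and cont: "continuous_map (subtopology (full_shift A) X) (subtopology (full_shift B) Y) f"
    and f: "\<And>x. x \<in> X \<Longrightarrow> f (shift x) = shift (f x)"
    using assms by (auto simp: shift_morphism_def)
  have XA: "X \<subseteq> topspace (full_shift A)"
    using shift_space_letters[OF X] by (auto simp: topspace_full_shift)
  have fY: "f x \<in> Y" if "x \<in> X" for x
    using cont that XA by (auto simp: continuous_map_def)
  define U where "U n = {x \<in> topspace (full_shift A). \<forall>z\<in>X. \<forall>z'\<in>X.
      (\<forall>i\<in>{- int n..int n}. z i = x i) \<longrightarrow> (\<forall>i\<in>{- int n..int n}. z' i = x i) \<longrightarrow> f z 0 = f z' 0}" for n :: nat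
  have U_open: "openin (full_shift A) (U n)" for n
    unfolding openin_full_shift
  proof (intro conjI ballI exI[of _ n] impI)
    fix x z assume x: "x \<in> U n" and z: "z \<in> topspace (full_shift A)" "\<forall>i\<in>{- int n..int n}. z i = x i"
    have "(\<forall>i\<in>{- int n..int n}. w i = z i) \<longleftrightarrow> (\<forall>i\<in>{- int n..int n}. w i = x i)" for w
      using z(2) by metis
    then show "z \<in> U n" using x z(1) unfolding U_def by blast
  qed (auto simp: U_def)
  have U_mono: "U n \<subseteq> U n'" if "n \<le> n'" for n n'
  proof -
    have "{- int n..int n} \<subseteq> {- int n'..int n'}" using that by auto
    then show ?thesis unfolding U_def by blast
  qed
  have cover: "\<exists>n. x \<in> U n" if x: "x \<in> X" for x
  proof -
    define W where "W = {y \<in> topspace (full_shift B). y 0 = f x 0}"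
    have "openin (full_shift B) W"
      unfolding openin_full_shift by (auto simp: W_def intro!: exI[of _ 0])
    then have "openin (subtopology (full_shift B) Y) (W \<inter> Y)"
      by (auto simp: openin_subtopology)
    then have "openin (subtopology (full_shift A) X) {z \<in> topspace (subtopology (full_shift A) X). f z \<in> W \<inter> Y}"
      using cont unfolding continuous_map by blast
    then obtain T where T: "openin (full_shift A) T"
        "{z \<in> topspace (subtopology (full_shift A) X). f z \<in> W \<inter> Y} = T \<inter> X"
      by (auto simp: openin_subtopology)
    have "f x \<in> W" using fY[OF x] shift_space_letters[OF Y] by (auto simp: W_def topspace_full_shift)
    then have "x \<in> T" using T(2) x XA fY by auto
    then obtain n :: nat
      where n: "\<And>z. z \<in> topspace (full_shift A) \<Longrightarrow> \<forall>i\<in>{- int n..int n}. z i = x i \<Longrightarrow> z \<in> T"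
      using T(1) unfolding openin_full_shift by blast
    have same: "f z 0 = f x 0" if "z \<in> X" "\<forall>i\<in>{- int n..int n}. z i = x i" for z
    proof -
      have "z \<in> T \<inter> X" using n that XA by auto
      then show ?thesis unfolding T(2)[symmetric] by (auto simp: W_def)
    qed
    have "x \<in> U n"
      unfolding U_def using x XA by (auto simp only: same mem_Collect_eq subset_iff)
    then show ?thesis by blast
  qed
  then have "X \<subseteq> \<Union> (range U)" by blast
  moreover have "\<forall>V\<in>range U. openin (full_shift A) V" using U_open by blast
  ultimately have "\<exists>\<F>. finite \<F> \<and> \<F> \<subseteq> range U \<and> X \<subseteq> \<Union>\<F>"
    using compact_space_shift_space[OF X] unfolding compactin_def by presburger
  then obtain \<F> where \<F>: "finite \<F>" "\<F> \<subseteq> range U" "X \<subseteq> \<Union>\<F>" by blast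
  then obtain N where N: "finite N" "\<F> = U ` N" by (meson finite_subset_image)
  define n where "n = Max (insert 0 N)"
  have n: "X \<subseteq> U n"
  proof
    fix x assume "x \<in> X"
    then obtain k where "k \<in> N" "x \<in> U k" using \<F>(3) N(2) by auto
    moreover have "k \<le> n" using \<open>k \<in> N\<close> N(1) by (simp add: n_def)
    ultimately show "x \<in> U n" using U_mono by blast
  qed
  have "block_map X (int n) f"
    unfolding block_map_def
  proof (intro ballI allI impI)
    fix x x' i assume x: "x \<in> X" "x' \<in> X"
      and agree: "\<forall>j. i - int n \<le> j \<longrightarrow> j \<le> i + int n \<longrightarrow> x j = x' j"
    have T: "translate i x \<in> X" "translate i x' \<in> X"
      using shift_space_translate[OF X] x by auto
    have "\<forall>j\<in>{- int n..int n}. translate i x' j = translate i x j"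
      using agree by (auto simp: translate_def)
    then have "f (translate i x) 0 = f (translate i x') 0"
      using n T unfolding U_def by blast
    then show "f x i = f x' i"
      by (simp add: shift_commute_translate[where f = f, OF X f] x translate_apply)
  qed
  then show ?thesis by (intro exI[of _ "int n"]) simp
qed

lemma block_map_continuous:
  assumes f: "block_map X m f" and X: "X \<subseteq> topspace (full_shift A)"
    and fY: "f ` X \<subseteq> Y" and Y: "Y \<subseteq> topspace (full_shift B)"
  shows "continuous_map (subtopology (full_shift A) X) (subtopology (full_shift B) Y) f"
proof -
  have "continuous_map (subtopology (full_shift A) X) (discrete_topology B) (\<lambda>x. f x i)" for i
    unfolding continuous_map
  proof (intro conjI allI impI)
    show "(\<lambda>x. f x i) ` topspace (subtopology (full_shift A) X) \<subseteq> topspace (discrete_topology B)"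
      using fY Y by (fastforce simp: topspace_full_shift)
    fix V assume "openin (discrete_topology B) V"
    define T where "T = {x \<in> topspace (full_shift A).
        \<exists>x'\<in>X. f x' i \<in> V \<and> (\<forall>j. i - m \<le> j \<longrightarrow> j \<le> i + m \<longrightarrow> x j = x' j)}"
    have "openin (full_shift A) T"
      unfolding openin_full_shift
    proof (intro conjI ballI)
      fix x assume "x \<in> T"
      then obtain x' where x': "x' \<in> X" "f x' i \<in> V" "\<forall>j. i - m \<le> j \<longrightarrow> j \<le> i + m \<longrightarrow> x j = x' j"
        by (auto simp: T_def)
      define n where "n = nat (\<bar>i\<bar> + \<bar>m\<bar>)"
      show "\<exists>n. \<forall>z\<in>topspace (full_shift A). (\<forall>i\<in>{- int n..int n}. z i = x i) \<longrightarrow> z \<in> T"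
      proof (intro exI[of _ n] ballI impI)
        fix z assume z: "z \<in> topspace (full_shift A)" "\<forall>i\<in>{- int n..int n}. z i = x i"
        have "z j = x' j" if "i - m \<le> j" "j \<le> i + m" for j
        proof -
          have "j \<in> {- int n..int n}" using that by (auto simp: n_def)
          then show ?thesis using x'(3) z(2) that by metis
        qed
        then show "z \<in> T" using x' z by (auto simp: T_def)
      qed
    qed (auto simp: T_def)
    moreover have "{x \<in> topspace (subtopology (full_shift A) X). f x i \<in> V} = T \<inter> X"
    proof (intro equalityI subsetI)
      fix x assume "x \<in> T \<inter> X"
      then obtain x' where "x' \<in> X" "f x' i \<in> V" "\<forall>j. i - m \<le> j \<longrightarrow> j \<le> i + m \<longrightarrow> x j = x' j"
        by (auto simp: T_def)
      moreover from this \<open>x \<in> T \<inter> X\<close> have "f x i = f x' i" using f unfolding block_map_def by blast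
      ultimately show "x \<in> {x \<in> topspace (subtopology (full_shift A) X). f x i \<in> V}"
        using \<open>x \<in> T \<inter> X\<close> X by auto
    qed (auto simp: T_def)
    ultimately show "openin (subtopology (full_shift A) X)
        {x \<in> topspace (subtopology (full_shift A) X). f x i \<in> V}"
      by (auto simp: openin_subtopology)
  qed
  then have "continuous_map (subtopology (full_shift A) X) (full_shift B) f"
    by (simp add: full_shift_def continuous_map_componentwise_UNIV)
  then show ?thesis using fY by (auto simp: continuous_map_in_subtopology)
qed

text \<open>A continuous bijection from a compact onto a Hausdorff space has a continuous inverse.\<close>
lemma conjugacy_inverse:
  assumes "conjugacy A X B Y f"
  shows "shift_morphism B Y A X (inv_into X f)"
proof -
  have X: "shift_space A X" and Y: "shift_space B Y"
    and cont: "continuous_map (subtopology (full_shift A) X) (subtopology (full_shift B) Y) f"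
    and f: "\<And>x. x \<in> X \<Longrightarrow> f (shift x) = shift (f x)" and bij: "bij_betw f X Y"
    using assms by (auto simp: conjugacy_def shift_morphism_def)
  have top: "topspace (subtopology (full_shift A) X) = X" "topspace (subtopology (full_shift B) Y) = Y"
    using shift_space_letters[OF X] shift_space_letters[OF Y] by (auto simp: topspace_full_shift)
  have "compact_space (subtopology (full_shift A) X)"
    using compact_space_shift_space[OF X] by (rule compact_space_subtopology)
  moreover have "Hausdorff_space (subtopology (full_shift B) Y)"
    by (auto simp: full_shift_def Hausdorff_space_product_topology intro: Hausdorff_space_subtopology)
  ultimately have "continuous_map (subtopology (subtopology (full_shift B) Y) Y)
      (subtopology (full_shift A) X) (inv_into X f)"
    by (rule continuous_inverse_map[OF _ _ cont])
      (simp_all only: top bij_betw_inv_into_left[OF bij] bij_betw_imp_surj_on[OF bij] subset_refl)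
  then have "continuous_map (subtopology (full_shift B) Y) (subtopology (full_shift A) X) (inv_into X f)"
    by (simp add: subtopology_subtopology)
  moreover have "inv_into X f (shift y) = shift (inv_into X f y)" if y: "y \<in> Y" for y
  proof -
    obtain x where x: "x \<in> X" "y = f x" using bij_betw_imp_surj_on[OF bij] y by blast
    have "shift x \<in> X" using X x(1) by (auto simp: shift_space_def)
    then show ?thesis using x bij f by (metis bij_betw_inv_into_left)
  qed
  ultimately show ?thesis using X Y by (simp add: shift_morphism_def)
qed

lemma conjugacy_block_conjugacy:
  assumes "conjugacy A X B Y f"
  shows "\<exists>m. block_conjugacy X Y f (inv_into X f) m"
proof -
  let ?g = "inv_into X f"
  have f: "shift_morphism A X B Y f" and bij: "bij_betw f X Y"
    using assms by (auto simp: conjugacy_def)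
  have g: "shift_morphism B Y A X ?g" using assms by (rule conjugacy_inverse)
  have X: "shift_space A X" and Y: "shift_space B Y" using f by (auto simp: shift_morphism_def)
  interpret X: subshift X using X by (rule shift_space_imp_subshift)
  interpret Y: subshift Y using Y by (rule shift_space_imp_subshift)
  obtain m1 m2 where m: "0 \<le> m1" "block_map X m1 f" "0 \<le> m2" "block_map Y m2 ?g"
    using shift_morphism_block_map f g by metis
  define m where "m = max m1 m2"
  have bf: "block_map X m f" and bg: "block_map Y m ?g"
    unfolding m_def by (simp_all add: block_map_mono[OF m(2)] block_map_mono[OF m(4)])
  have "block_conjugacy X Y f ?g m"
  proof
    show "0 \<le> m" using m by (simp add: m_def)
    show "f x \<in> Y" "?g (f x) = x" if "x \<in> X" for x
      using bij that by (auto simp: bij_betw_def)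
    show "?g y \<in> X" "f (?g y) = y" if "y \<in> Y" for y
      using bij that by (auto simp: bij_betw_def inv_into_into f_inv_into_f)
    show "f (translate k x) = translate k (f x)" if "x \<in> X" for x k
      using f that by (intro shift_commute_translate[OF X]) (auto simp: shift_morphism_def)
    show "?g (translate k y) = translate k (?g y)" if "y \<in> Y" for y k
      using g that by (intro shift_commute_translate[OF Y]) (auto simp: shift_morphism_def)
  qed (use bf bg in \<open>unfold block_map_def, blast+\<close>)
  then show ?thesis by blast
qed

section \<open>The Krieger cover of a sofic shift is finite\<close>

text \<open>When \<open>N\<close> bounds the lengths of the forbidden words, an occurrence of such a word in the glued
sequence starting left of \<open>0\<close> ends before \<open>N\<close> and so lies in \<open>y\<close>; any other occurrence lies in \<open>y'\<close>.\<close>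
lemma shift_of_finite_type_glue:
  assumes "shift_of_finite_type B Y"
  shows "\<exists>N. \<forall>y\<in>Y. \<forall>y'\<in>Y. (\<forall>i. - N \<le> i \<longrightarrow> i < N \<longrightarrow> y i = y' i) \<longrightarrow> glue y 0 y' \<in> Y"
proof -
  obtain F where F: "finite F" "Y = {x \<in> topspace (full_shift B). \<forall>w\<in>F. \<not> occurs_in w x}"
    using assms by (auto simp: shift_of_finite_type_def)
  define N where "N = int (Max (insert 0 (length ` F)))"
  have N: "int (length w) \<le> N" if "w \<in> F" for w
    using F(1) that by (simp add: N_def)
  have "glue y 0 y' \<in> Y" (is "?z \<in> Y")
    if y: "y \<in> Y" "y' \<in> Y" and agree: "\<forall>i. - N \<le> i \<longrightarrow> i < N \<longrightarrow> y i = y' i" for y y'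
  proof -
    have "\<not> occurs_in w ?z" if w: "w \<in> F" for w
    proof
      assume "occurs_in w ?z"
      then obtain i where i: "\<forall>k<length w. ?z (i + int k) = w ! k" by (auto simp: occurs_in_def)
      show False
      proof (cases "i < 0")
        case True
        have "y (i + int k) = w ! k" if "k < length w" for k
        proof -
          have "?z (i + int k) = y (i + int k)"
            using True N[OF w] that agree by (cases "i + int k < 0") auto
          then show ?thesis using i that by simp
        qed
        then have "occurs_in w y" by (auto simp: occurs_in_def)
        then show False using y(1) w by (auto simp: F(2))
      next
        case False
        then have "occurs_in w y'" using i by (auto simp: occurs_in_def)
        then show False using y(2) w by (auto simp: F(2))
      qed
    qed
    moreover have "?z \<in> topspace (full_shift B)"
      using y by (auto simp: F(2) topspace_full_shift glue_def)
    ultimately show ?thesis by (simp add: F(2))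
  qed
  then show ?thesis by blast
qed

text \<open>Let \<open>X\<close> be the image of a shift of finite type \<open>Y\<close> under a block map \<open>f\<close>. The predecessor set of \<open>x\<close>
is determined by the finite set \<open>T x\<close> of central words of those \<open>y\<close> whose image has the same right
half as \<open>x\<close>: a past of \<open>x\<close> comes from such a \<open>y\<close>, and if \<open>x'\<close> allows the same central word, through
\<open>y'\<close> say, then \<open>y\<close> and \<open>y'\<close> can be glued along it.\<close>
lemma finite_left_krieger_cover:
  assumes "sofic A X"
  shows "finite (verts (left_krieger_cover X))"
proof -
  have X: "shift_space A X" using assms by (simp add: sofic_def)
  interpret subshift X using X by (rule shift_space_imp_subshift)
  obtain B :: "nat set" and Y f where Y: "shift_of_finite_type B Y"
      and f: "shift_morphism B Y A X f" and fY: "f ` Y = X"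
    using assms by (auto simp: sofic_def)
  have B: "finite B" and YB: "\<And>y i. y \<in> Y \<Longrightarrow> y i \<in> B"
    using Y by (auto simp: shift_of_finite_type_def topspace_full_shift)
  obtain N0 where N0: "\<And>y y'. y \<in> Y \<Longrightarrow> y' \<in> Y \<Longrightarrow>
      (\<And>i. - N0 \<le> i \<Longrightarrow> i < N0 \<Longrightarrow> y i = y' i) \<Longrightarrow> glue y 0 y' \<in> Y"
    using shift_of_finite_type_glue[OF Y] by metis
  obtain m where m: "0 \<le> m" "block_map Y m f" using shift_morphism_block_map[OF f] by blast
  define N where "N = max N0 m"
  define centre where "centre y = map y [- N..N - 1]" for y :: "int \<Rightarrow> nat"
  define T where "T x = centre ` {y \<in> Y. \<forall>i\<ge>0. f y i = x i}" for x
  have subset: "pred_set X x 0 \<subseteq> pred_set X x' 0" if x: "T x = T x'" for x x'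
    unfolding pred_set_subset_iff
  proof (intro allI impI)
    fix u assume "glue u 0 x \<in> X"
    then obtain y where y: "y \<in> Y" "f y = glue u 0 x" using fY by (metis imageE)
    then have "centre y \<in> T x" by (auto simp: T_def)
    then obtain y' where y': "y' \<in> Y" "\<And>i. i \<ge> 0 \<Longrightarrow> f y' i = x' i" "centre y = centre y'"
      unfolding x by (auto simp: T_def)
    have eq: "y i = y' i" if "- N \<le> i" "i < N" for i
      using y'(3) that by (auto simp: centre_def)
    have z: "glue y 0 y' \<in> Y" (is "?z \<in> Y")
      using eq by (intro N0 y y') (auto simp: N_def)
    have zy: "?z i = y i" if "i < N" for i using that eq m(1) by (cases "i < 0") (auto simp: N_def)
    have zy': "?z i = y' i" if "- N \<le> i" for i
      using that eq m(1) by (cases "i < 0") (auto simp: N_def)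
    have "glue u 0 x' = f ?z"
    proof (rule glue_eqI)
      fix i :: int assume "i < 0"
      then have "f ?z i = f y i"
        using zy m(1) by (intro block_map_apply[OF m(2) z y(1)]) (simp add: N_def)
      then show "f ?z i = u i" using y(2) \<open>i < 0\<close> by simp
    next
      fix i :: int assume "0 \<le> i"
      then have "f ?z i = f y' i"
        using zy' m(1) by (intro block_map_apply[OF m(2) z y'(1)]) (simp add: N_def)
      then show "f ?z i = x' i" using y'(2) \<open>0 \<le> i\<close> by simp
    qed
    then show "glue u 0 x' \<in> X" using z fY by auto
  qed
  have "T x \<subseteq> {ws. set ws \<subseteq> B \<and> length ws = nat (2 * N)}" for x
    using YB by (auto simp: T_def centre_def)
  then have "range T \<subseteq> Pow {ws. set ws \<subseteq> B \<and> length ws = nat (2 * N)}" by blast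
  then have "finite (T ` X)"
    using finite_lists_length_eq[OF B] by (meson finite_Pow_iff finite_subset subset_UNIV image_mono)
  moreover have "verts K = (\<lambda>C. pred_set X (inv_into X T C) 0) ` T ` X"
    unfolding verts_K[of 0] image_image
    by (intro image_cong refl equalityI subset) (simp_all add: f_inv_into_f)
  ultimately show ?thesis by simp
qed

lemma shift_space_edge_shift:
  assumes "finite (arcs E)"
  shows "shift_space (arcs E) (edge_shift E)"
proof -
  have sub: "edge_shift E \<subseteq> topspace (full_shift (arcs E))"
    by (auto simp: edge_shift_def topspace_full_shift)
  have "openin (full_shift (arcs E)) (topspace (full_shift (arcs E)) - edge_shift E)"
    unfolding openin_full_shift
  proof (intro conjI ballI)
    fix x assume x: "x \<in> topspace (full_shift (arcs E)) - edge_shift E"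
    then obtain i where i: "head E (x i) \<noteq> tail E (x (i + 1))"
      by (auto simp: edge_shift_def topspace_full_shift)
    define n where "n = nat (\<bar>i\<bar> + 1)"
    show "\<exists>n::nat. \<forall>z\<in>topspace (full_shift (arcs E)). (\<forall>i\<in>{- int n..int n}. z i = x i) \<longrightarrow>
        z \<in> topspace (full_shift (arcs E)) - edge_shift E"
    proof (intro exI[of _ n] ballI impI)
      fix z assume z: "z \<in> topspace (full_shift (arcs E))" "\<forall>i\<in>{- int n..int n}. z i = x i"
      moreover have "i \<in> {- int n..int n}" "i + 1 \<in> {- int n..int n}" by (auto simp: n_def)
      ultimately have "z i = x i" "z (i + 1) = x (i + 1)" by blast+
      then have "z \<notin> edge_shift E" using i by (auto simp: edge_shift_def) metis
      then show "z \<in> topspace (full_shift (arcs E)) - edge_shift E" using z(1) by blast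
    qed
  qed blast
  then have "closedin (full_shift (arcs E)) (edge_shift E)"
    using sub by (simp add: closedin_def)
  moreover have "shift ` edge_shift E = edge_shift E"
  proof (intro equalityI subsetI)
    fix x assume x: "x \<in> edge_shift E"
    have "translate (- 1) x \<in> edge_shift E"
    proof -
      have "head E (x (i - 1)) = tail E (x i)" for i
        using x by (auto simp: edge_shift_def dest: spec[of _ "i - 1"])
      then show ?thesis using x by (auto simp: edge_shift_def translate_def)
    qed
    moreover have "x = shift (translate (- 1) x)" by (simp add: shift_eq_translate)
    ultimately show "x \<in> shift ` edge_shift E" by blast
  qed (auto simp: edge_shift_def shift_def)
  ultimately show ?thesis using assms by (simp add: shift_space_def)
qed

lemma finite_arcs_fischer:
  assumes "sofic A X"
  shows "finite (arcs (generalized_left_fischer_cover X))"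
proof -
  have X: "shift_space A X" using assms by (simp add: sofic_def)
  interpret subshift X using X by (rule shift_space_imp_subshift)
  have "arcs K \<subseteq> verts K \<times> A \<times> verts K"
  proof
    fix e assume "e \<in> arcs K"
    moreover obtain P a P' where e: "e = (P, a, P')" by (cases e)
    ultimately obtain x where x: "x \<in> X" "P = pred_set X x 0" "a = x 0" "P' = pred_set X x (0 + 1)"
      using arcs_K[where n = 0] by blast
    then show "e \<in> verts K \<times> A \<times> verts K"
      unfolding e using verts_K[of 0] verts_K[of "0 + 1"] shift_space_letters[OF X x(1)] by blast
  qed
  moreover have "finite A" using X by (simp add: shift_space_def)
  ultimately have "finite (arcs K)"
    using finite_left_krieger_cover[OF assms] by (meson finite_SigmaI finite_subset)
  then show ?thesis
    by (simp add: generalized_left_fischer_cover_def induce_subgraph_def)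
qed

section \<open>The generalized left Fischer cover is canonical\<close>

theorem theorem3p11:
  fixes A1 :: "'a set" and X1 :: "(int \<Rightarrow> 'a) set"
    and A2 :: "'b set" and X2 :: "(int \<Rightarrow> 'b) set"
    and \<Phi> :: "(int \<Rightarrow> 'a) \<Rightarrow> int \<Rightarrow> 'b"
  defines "G1 \<equiv> generalized_left_fischer_cover X1"
    and "G2 \<equiv> generalized_left_fischer_cover X2"
  assumes "sofic A1 X1" and "sofic A2 X2"
    and "conjugacy A1 X1 A2 X2 \<Phi>"
  shows "\<exists>\<phi>. conjugacy (arcs G1) (edge_shift G1) (arcs G2) (edge_shift G2) \<phi> \<and>
           (\<forall>x \<in> edge_shift G1.
              \<Phi> (covering_map krieger_label x) = covering_map krieger_label (\<phi> x))"
proof -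
  obtain m where "block_conjugacy X1 X2 \<Phi> (inv_into X1 \<Phi>) m"
    using conjugacy_block_conjugacy[OF assms(5)] by blast
  then interpret block_conjugacy X1 X2 \<Phi> "inv_into X1 \<Phi>" m .
  have sub: "edge_shift G1 \<subseteq> edge_shift (left_krieger_cover X1)"
    by (auto simp: G1_def X.edge_shift_G)
  have S: "shift_space (arcs G1) (edge_shift G1)" "shift_space (arcs G2) (edge_shift G2)"
    unfolding G1_def G2_def using assms(3,4) by (auto intro: shift_space_edge_shift finite_arcs_fischer)
  have bij: "bij_betw lift (edge_shift G1) (edge_shift G2)"
    unfolding G1_def G2_def using assms(3,4) by (intro bij_betw_lift finite_left_krieger_cover)
  have "block_map (edge_shift G1) (3 * m) lift"
    unfolding block_map_def using sub by (intro ballI allI impI lift_local) auto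
  then have "continuous_map (subtopology (full_shift (arcs G1)) (edge_shift G1))
      (subtopology (full_shift (arcs G2)) (edge_shift G2)) lift"
    using bij_betw_imp_surj_on[OF bij] shift_space_letters[OF S(1)] shift_space_letters[OF S(2)]
    by (intro block_map_continuous) (auto simp: topspace_full_shift)
  then have "conjugacy (arcs G1) (edge_shift G1) (arcs G2) (edge_shift G2) lift"
    using S bij sub lift_shift by (auto simp: conjugacy_def shift_morphism_def)
  then show ?thesis using sub covering_map_lift by blast
qed

end
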